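(* (1) For every transfinite $\times$-number $\lambda$, the ring $\mathcal{Z}_\lambda$ is discrete. (2) $\mathcal{Z}=\mathcal{Z}_\omega$ is cyclic. (3) For a transfinite $\times$-number $\lambda$, $\mathcal{Z}_\lambda$ is cyclic if and only if $\lambda=\omega$.
   Context: $\oplus,\otimes$ are the natural (Hessenberg) sum and product of ordinals. An ordinal $\lambda\ge\omega$ with $\beta\otimes\gamma<\lambda$ for all $\beta,\gamma<\lambda$ is a transfinite $\times$-number. $\mathbb{Z}_\infty$ is the class of pairs $(\alpha,\beta)$ of ordinals whose Cantor normal forms share no exponent, identified with finite formal sums $\sum_\zeta\omega^\zeta c_\zeta$ with $c_\zeta\in\mathbb{Z}$ (positive coefficients from $\beta$, negated coefficients from $\alpha$); $1^{st},2^{nd}$ denote coordinates. Addition is coefficientwise, $-(\alpha,\beta)=(\beta,\alpha)$, multiplication is $(\sum\omega^\zeta c_\zeta)(\sum\omega^\eta d_\eta)=\sum_\theta\omega^\theta\sum_{\zeta\oplus\eta=\theta}c_\zeta d_\eta$, $0=(0,0)$, $1=(0,1)$. With $\mathbb{Z}_\infty^+=\{a:1^{st}a\le2^{nd}a\}$, $\mathbb{Z}_\infty^-=\{a:2^{nd}a<1^{st}a\}$: $a\le b$ iff ($a\in\mathbb{Z}_\infty^-,b\in\mathbb{Z}_\infty^+$) or ($a,b\in\mathbb{Z}_\infty^+$ and [$2^{nd}a<2^{nd}b$ or ($2^{nd}a=2^{nd}b$ and $1^{st}b\le1^{st}a$)]) or ($a,b\in\mathbb{Z}_\infty^-$ and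 [$1^{st}b<1^{st}a$ or ($1^{st}a=1^{st}b$ and $2^{nd}a\le2^{nd}b$)]). $\mathbb{Z}_\lambda=\{a\in\mathbb{Z}_\infty:1^{st}a<\lambda,2^{nd}a<\lambda\}$ and $\mathcal{Z}_\lambda=\langle\mathbb{Z}_\lambda,\le,+,-,\times,0,1\rangle$ with restricted order and operations. A ring (ordered, with these components) is discrete if there are no $x,y$ with $x<y<x+1$, and cyclic if every element is $\sum_{i<n}1$ or $-\sum_{i<n}1$ for some natural number $n$.
   Formalization: The order is a ≤ b iff b − a ∈ Z_∞^+, replacing the coordinatewise same-sign clauses; under those, (1) fails for every λ > ω, since ω²−ω < ω² < (ω²−ω)+1. For λ = ω the two orders agree. *)

theory Defs
  imports "HOL-Algebra.Ring"
begin

section \<open>Ordinals\<close>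

text \<open>
  HOL has no type of all ordinals. For a type \<open>'a\<close>, the type \<open>'a ordinal\<close> consists of the order
  types of the well-orders on subsets of \<open>'a + nat\<close>, that is, of the ordinals of cardinality at most
  \<open>\<kappa> = max |'a| \<aleph>\<^sub>0\<close>. It is an initial segment of the ordinals, of order type the successor cardinal
  of \<open>\<kappa>\<close>, so it contains \<open>\<omega>\<close> and is closed under suprema of at most \<open>\<kappa>\<close> many elements
  and under the ordinal operations below. Every well-order of HOL has its order type in some
  instance, and the structures built from an ordinal \<open>\<mu>\<close> involve ordinals below \<open>\<mu>\<close> only; hence
  "for all ordinals" is rendered by a quantifier over \<open>'a ordinal\<close> with \<open>'a\<close> a free type variable.
\<close>

quotient_type 'a ordinal = "('a + nat) rel" / partial: "\<lambda>r s. (r, s) \<in> ordIso"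
proof (rule part_equivpI)
  have "Well_order ({} :: ('a + nat) rel)"
    by (simp add: well_order_on_empty)
  then show "\<exists>r :: ('a + nat) rel. (r, r) \<in> ordIso"
    using ordIso_reflexive by blast
  show "symp (\<lambda>r s :: ('a + nat) rel. (r, s) \<in> ordIso)"
    by (auto intro: sympI ordIso_symmetric)
  show "transp (\<lambda>r s :: ('a + nat) rel. (r, s) \<in> ordIso)"
    by (auto intro: transpI ordIso_transitive)
qed

instantiation ordinal :: (type) ord
begin

lift_definition less_eq_ordinal :: "'a ordinal \<Rightarrow> 'a ordinal \<Rightarrow> bool"
  is "\<lambda>r s. (r, s) \<in> ordLeq"
  by (meson ordIso_ordLeq_trans ordIso_symmetric ordLeq_ordIso_trans)

lift_definition less_ordinal :: "'a ordinal \<Rightarrow> 'a ordinal \<Rightarrow> bool"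
  is "\<lambda>r s. (r, s) \<in> ordLess"
  by (meson ordIso_ordLess_trans ordIso_symmetric ordLess_ordIso_trans)

instance ..

end

lemma ordIso_refl_iff: "(r, r) \<in> ordIso \<longleftrightarrow> Well_order r"
  using ordIso_reflexive by (auto simp: ordIso_def)

instance ordinal :: (type) wellorder
proof
  fix x y z :: "'a ordinal"
  show "x < y \<longleftrightarrow> x \<le> y \<and> \<not> y \<le> x"
    by transfer (auto simp: ordIso_refl_iff not_ordLeq_iff_ordLess intro: ordLess_imp_ordLeq)
  show "x \<le> x"
    by transfer (simp add: ordIso_refl_iff ordLeq_reflexive)
  show "x \<le> y \<Longrightarrow> y \<le> z \<Longrightarrow> x \<le> z"
    by transfer (rule ordLeq_transitive)
  show "x \<le> y \<Longrightarrow> y \<le> x \<Longrightarrow> x = y"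
    by transfer (simp add: ordIso_iff_ordLeq)
  show "x \<le> y \<or> y \<le> x"
    by transfer (auto simp: ordIso_refl_iff ordLeq_total)
next
  fix P :: "'a ordinal \<Rightarrow> bool" and a
  assume step: "\<And>x. (\<And>y. y < x \<Longrightarrow> P y) \<Longrightarrow> P x"
  have *: "(r, r) \<in> ordIso \<Longrightarrow> P (abs_ordinal r)" for r
  proof (induction r rule: wf_induct_rule[OF wf_ordLess])
    case (1 r)
    have "P y" if "y < abs_ordinal r" for y
      using that
    proof (induction y rule: ordinal.abs_induct)
      fix s :: "('a + nat) rel"
      assume s: "(s, s) \<in> ordIso" and less: "abs_ordinal s < abs_ordinal r"
      have "(s, r) \<in> ordLess"
        using less unfolding less_ordinal.abs_eq[OF s 1(2)] .
      then show "P (abs_ordinal s)"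
        using 1(1) s by blast
    qed
    then show ?case by (rule step)
  qed
  show "P a"
    by (rule ordinal.abs_induct) (rule *)
qed

text \<open>
  In the following recursions \<open>LEAST\<close> takes a supremum. For instance, \<open>\<alpha> + \<beta>\<close> is the supremum of
  \<open>\<alpha>\<close> and all \<open>(\<alpha> + \<beta>') + 1\<close> with \<open>\<beta>' < \<beta>\<close>, which merges the usual zero, successor and limit
  clauses; likewise for products and powers of \<open>\<omega>\<close>.
\<close>

definition ord_zero :: "'a ordinal"
  where "ord_zero = (LEAST \<gamma>. True)"

definition ord_succ :: "'a ordinal \<Rightarrow> 'a ordinal"
  where "ord_succ \<alpha> = (LEAST \<gamma>. \<alpha> < \<gamma>)"

primrec ord_of_nat :: "nat \<Rightarrow> 'a ordinal"
  where
    "ord_of_nat 0 = ord_zero"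
  | "ord_of_nat (Suc n) = ord_succ (ord_of_nat n)"

definition ord_omega :: "'a ordinal"
  where "ord_omega = (LEAST \<gamma>. \<forall>n. ord_of_nat n < \<gamma>)"

function ord_add :: "'a ordinal \<Rightarrow> 'a ordinal \<Rightarrow> 'a ordinal"
  where "ord_add \<alpha> \<beta> = (LEAST \<gamma>. \<alpha> \<le> \<gamma> \<and> (\<forall>\<beta>'. \<beta>' < \<beta> \<longrightarrow> ord_add \<alpha> \<beta>' < \<gamma>))"
  by auto
termination
  by (relation "inv_image {(x, y). x < y} snd") (rule wf_inv_image, rule wf, simp)

declare ord_add.simps [simp del]

function ord_mult :: "'a ordinal \<Rightarrow> 'a ordinal \<Rightarrow> 'a ordinal"
  where "ord_mult \<alpha> \<beta> = (LEAST \<gamma>. \<forall>\<beta>'. \<beta>' < \<beta> \<longrightarrow> ord_add (ord_mult \<alpha> \<beta>') \<alpha> \<le> \<gamma>)"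
  by auto
termination
  by (relation "inv_image {(x, y). x < y} snd") (rule wf_inv_image, rule wf, simp)

declare ord_mult.simps [simp del]

function omega_power :: "'a ordinal \<Rightarrow> 'a ordinal"
  where "omega_power \<beta> = (LEAST \<gamma>. ord_of_nat 1 \<le> \<gamma> \<and>
    (\<forall>\<beta>'. \<beta>' < \<beta> \<longrightarrow> ord_mult (omega_power \<beta>') ord_omega \<le> \<gamma>))"
  by auto
termination
  by (relation "{(x, y). x < y}") (rule wf, simp)

declare omega_power.simps [simp del]


section \<open>Cantor normal forms and the natural operations\<close>

text \<open>
  The list \<open>[(\<zeta>\<^sub>1, c\<^sub>1), \<dots>, (\<zeta>\<^sub>k, c\<^sub>k)]\<close> stands for \<open>\<omega>\<^bsup>\<zeta>\<^sub>1\<^esup> c\<^sub>1 + \<dots> + \<omega>\<^bsup>\<zeta>\<^sub>k\<^esup> c\<^sub>k\<close>; it is a normal form if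
  \<open>\<zeta>\<^sub>1 > \<dots> > \<zeta>\<^sub>k\<close> and all \<open>c\<^sub>i > 0\<close>.
\<close>

definition cnf_value :: "('a ordinal \<times> nat) list \<Rightarrow> 'a ordinal"
  where "cnf_value xs =
    foldr (\<lambda>(\<zeta>, c). ord_add (ord_mult (omega_power \<zeta>) (ord_of_nat c))) xs ord_zero"

definition is_cnf :: "('a ordinal \<times> nat) list \<Rightarrow> bool"
  where "is_cnf xs \<longleftrightarrow> sorted_wrt (>) (map fst xs) \<and> (\<forall>(\<zeta>, c) \<in> set xs. 0 < c)"

definition cnf :: "'a ordinal \<Rightarrow> ('a ordinal \<times> nat) list"
  where "cnf \<alpha> = (THE xs. is_cnf xs \<and> cnf_value xs = \<alpha>)"

definition exponents :: "'a ordinal \<Rightarrow> 'a ordinal set"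
  where "exponents \<alpha> = fst ` set (cnf \<alpha>)"

definition cnf_coeff :: "'a ordinal \<Rightarrow> 'a ordinal \<Rightarrow> nat"
  where "cnf_coeff \<alpha> \<zeta> = (case map_of (cnf \<alpha>) \<zeta> of None \<Rightarrow> 0 | Some c \<Rightarrow> c)"

text \<open>The ordinal with a given finitely supported family of coefficients.\<close>

definition ord_of_coeffs :: "('a ordinal \<Rightarrow> nat) \<Rightarrow> 'a ordinal"
  where "ord_of_coeffs c =
    cnf_value (map (\<lambda>\<zeta>. (\<zeta>, c \<zeta>)) (rev (sorted_list_of_set {\<zeta>. c \<zeta> \<noteq> 0})))"

definition nat_sum :: "'a ordinal \<Rightarrow> 'a ordinal \<Rightarrow> 'a ordinal"
  where "nat_sum \<alpha> \<beta> = ord_of_coeffs (\<lambda>\<zeta>. cnf_coeff \<alpha> \<zeta> + cnf_coeff \<beta> \<zeta>)"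

definition nat_prod :: "'a ordinal \<Rightarrow> 'a ordinal \<Rightarrow> 'a ordinal"
  where "nat_prod \<alpha> \<beta> = ord_of_coeffs (\<lambda>\<theta>.
    \<Sum>(\<zeta>, \<eta>) \<in> {(\<zeta>, \<eta>) \<in> exponents \<alpha> \<times> exponents \<beta>. nat_sum \<zeta> \<eta> = \<theta>}.
      cnf_coeff \<alpha> \<zeta> * cnf_coeff \<beta> \<eta>)"

definition transfinite_times_number :: "'a ordinal \<Rightarrow> bool"
  where "transfinite_times_number \<mu> \<longleftrightarrow>
    ord_omega \<le> \<mu> \<and> (\<forall>\<beta> \<gamma>. \<beta> < \<mu> \<and> \<gamma> < \<mu> \<longrightarrow> nat_prod \<beta> \<gamma> < \<mu>)"


section \<open>Transfinite integers\<close>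

type_synonym 'a ord_pair = "'a ordinal \<times> 'a ordinal"

definition Zinf :: "'a ord_pair set"
  where "Zinf = {(\<alpha>, \<beta>). exponents \<alpha> \<inter> exponents \<beta> = {}}"

text \<open>
  The passage between pairs and formal sums: the first coordinate carries the negative coefficients.
\<close>

definition zcoeff :: "'a ord_pair \<Rightarrow> 'a ordinal \<Rightarrow> int"
  where "zcoeff a \<zeta> = int (cnf_coeff (snd a) \<zeta>) - int (cnf_coeff (fst a) \<zeta>)"

definition zsupp :: "'a ord_pair \<Rightarrow> 'a ordinal set"
  where "zsupp a = {\<zeta>. zcoeff a \<zeta> \<noteq> 0}"

definition zinf_of_coeffs :: "('a ordinal \<Rightarrow> int) \<Rightarrow> 'a ord_pair"
  where "zinf_of_coeffs c =
    (ord_of_coeffs (\<lambda>\<zeta>. nat (- c \<zeta>)), ord_of_coeffs (\<lambda>\<zeta>. nat (c \<zeta>)))"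

definition zadd :: "'a ord_pair \<Rightarrow> 'a ord_pair \<Rightarrow> 'a ord_pair"
  where "zadd a b = zinf_of_coeffs (\<lambda>\<zeta>. zcoeff a \<zeta> + zcoeff b \<zeta>)"

definition zneg :: "'a ord_pair \<Rightarrow> 'a ord_pair"
  where "zneg a = (snd a, fst a)"

definition zmult :: "'a ord_pair \<Rightarrow> 'a ord_pair \<Rightarrow> 'a ord_pair"
  where "zmult a b = zinf_of_coeffs (\<lambda>\<theta>.
    \<Sum>(\<zeta>, \<eta>) \<in> {(\<zeta>, \<eta>) \<in> zsupp a \<times> zsupp b. nat_sum \<zeta> \<eta> = \<theta>}. zcoeff a \<zeta> * zcoeff b \<eta>)"

definition zzero :: "'a ord_pair"
  where "zzero = (ord_zero, ord_zero)"

definition zone :: "'a ord_pair"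
  where "zone = (ord_zero, ord_of_nat 1)"

definition Zinf_nonneg :: "'a ord_pair set"
  where "Zinf_nonneg = {a \<in> Zinf. fst a \<le> snd a}"

text \<open>
  The order is the ring order with nonnegative cone \<open>Zinf_nonneg\<close>: \<open>a \<le> b\<close> iff \<open>b - a\<close> is
  nonnegative, that is, iff \<open>a = b\<close> or the leading coefficient of \<open>b - a\<close> is positive. It is not the
  relation that compares elements of equal sign lexicographically by coordinates (for nonnegative
  \<open>a\<close>, \<open>b\<close>: first the second coordinates, then the first ones in reverse). That relation is sometimes
  given as the order of the transfinite integers, but it is not compatible with addition, and with
  it the rings below are not discrete for \<open>\<mu> > \<omega>\<close>: under it
  \<open>\<omega>\<^sup>2 - \<omega> < \<omega>\<^sup>2 < (\<omega>\<^sup>2 - \<omega>) + 1\<close>, as the pairs are \<open>(\<omega>, \<omega>\<^sup>2)\<close>, \<open>(0, \<omega>\<^sup>2)\<close> and \<open>(\<omega>, \<omega>\<^sup>2 + 1)\<close>.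
\<close>

definition zle :: "'a ord_pair \<Rightarrow> 'a ord_pair \<Rightarrow> bool"
  where "zle a b \<longleftrightarrow> zadd b (zneg a) \<in> Zinf_nonneg"


section \<open>The ordered rings\<close>

record 'b ordered_ring = "'b ring" +
  ring_le :: "'b \<Rightarrow> 'b \<Rightarrow> bool"
  ring_neg :: "'b \<Rightarrow> 'b"

text \<open>
  As usual in HOL-Algebra, the order and the operations are restricted to the carrier by only ever
  being applied to its elements.
\<close>

definition Z_ring :: "'a ordinal \<Rightarrow> 'a ord_pair ordered_ring"
  where "Z_ring \<mu> =
    \<lparr>carrier = {a \<in> Zinf. fst a < \<mu> \<and> snd a < \<mu>},
     mult = zmult, one = zone, zero = zzero, add = zadd,
     ring_le = zle, ring_neg = zneg\<rparr>"

definition ring_less :: "('b, 'm) ordered_ring_scheme \<Rightarrow> 'b \<Rightarrow> 'b \<Rightarrow> bool"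
  where "ring_less R x y \<longleftrightarrow> ring_le R x y \<and> x \<noteq> y"

definition discrete_ring :: "('b, 'm) ordered_ring_scheme \<Rightarrow> bool"
  where "discrete_ring R \<longleftrightarrow>
    \<not> (\<exists>x \<in> carrier R. \<exists>y \<in> carrier R.
      ring_less R x y \<and> ring_less R y (x \<oplus>\<^bsub>R\<^esub> \<one>\<^bsub>R\<^esub>))"

definition cyclic_ring :: "('b, 'm) ordered_ring_scheme \<Rightarrow> bool"
  where "cyclic_ring R \<longleftrightarrow>
    (\<forall>a \<in> carrier R. \<exists>n :: nat.
      a = [n] \<cdot>\<^bsub>R\<^esub> \<one>\<^bsub>R\<^esub> \<or> a = ring_neg R ([n] \<cdot>\<^bsub>R\<^esub> \<one>\<^bsub>R\<^esub>))"

end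

theory Submission
  imports Defs
begin

text \<open>
  Ordinals are compared lexicographically by their Cantor normal forms, so the sign of a transfinite
  integer is that of its leading coefficient. If \<open>x < y < x + 1\<close>, then \<open>y - x\<close> and \<open>1 - (y - x)\<close> both have
  positive leading coefficients. Their coefficients at positive exponents are opposite, so \<open>y - x\<close>
  has none there and is a natural number strictly between 0 and 1. The cyclic elements are exactly
  the pairs \<open>(0, n)\<close> and \<open>(n, 0)\<close>; for \<open>\<mu> = \<omega>\<close> every element has this form because the coordinates
  cannot share the exponent \<open>0\<close>, and for \<open>\<mu> > \<omega>\<close> the element \<open>(0, \<omega>)\<close> does not.
\<close>

section \<open>Bounds for small sets of ordinals\<close>

lemma infinite_UNIV_sum_nat: "infinite (UNIV :: ('a + nat) set)"
  by (simp add: finite_Plus_UNIV_iff)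

lemma Well_order_class: "Well_order {(x, y). x \<le> (y :: 'b :: wellorder)}"
proof -
  have "{(x, y). x \<le> (y :: 'b)} - Id = {(x, y). x < y}" by auto
  moreover have "linear_order_on UNIV {(x, y). x \<le> (y :: 'b)}"
    by (auto simp: linear_order_on_def partial_order_on_def preorder_on_def
        total_on_def intro: refl_onI transI antisymI)
  ultimately have "well_order_on UNIV {(x, y). x \<le> (y :: 'b)}"
    unfolding well_order_on_def using wf by simp
  moreover have "Field {(x, y). x \<le> (y :: 'b)} = UNIV" by (auto simp: Field_def)
  ultimately show ?thesis by simp
qed

text \<open>Every ordinal below the order type of \<open>r\<close> is the type of a proper initial
  segment of \<open>r\<close>. Such a segment is named by its end point in \<open>'a + nat\<close>,
  so the end points cover all these ordinals.\<close>

lemma card_of_lessThan_ordinal: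
  includes cardinal_syntax
  shows "|{..< (\<alpha> :: 'a ordinal)}| \<le>o |UNIV :: ('a + nat) set|"
proof (induction \<alpha> rule: ordinal.abs_induct)
  case (1 r)
  then have r: "Well_order r" by (simp add: ordIso_refl_iff)
  have "{..< abs_ordinal r} \<subseteq> (\<lambda>a. abs_ordinal (Restr r (underS r a))) ` UNIV"
  proof
    fix \<beta> assume "\<beta> \<in> {..< abs_ordinal r}"
    then have "\<beta> < abs_ordinal r" by simp
    then show "\<beta> \<in> (\<lambda>a. abs_ordinal (Restr r (underS r a))) ` UNIV"
    proof (induction \<beta> rule: ordinal.abs_induct)
      case (1 s)
      then have s: "Well_order s" by (simp add: ordIso_refl_iff)
      have "(s, r) \<in> ordLess"
        using 1 \<open>(r, r) \<in> ordIso\<close> by (simp add: less_ordinal.abs_eq)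
      then obtain a where "(s, Restr r (underS r a)) \<in> ordIso"
        using ordLess_iff_ordIso_Restr[OF r s] by blast
      then have "abs_ordinal s = abs_ordinal (Restr r (underS r a))"
        by (rule Quotient3_rel_abs[OF Quotient3_ordinal])
      then show ?case by blast
    qed
  qed
  then show ?case by (meson card_of_mono1 card_of_image ordLeq_transitive)
qed

text \<open>Hartogs: transporting the order of the ordinals along \<open>g\<close> would give an ordinal
  above all ordinals.\<close>

lemma not_inj_ordinal: "\<not> inj (g :: 'a ordinal \<Rightarrow> 'a + nat)"
proof
  assume g: "inj g"
  define r where "r = dir_image {(x, y). x \<le> y} g"
  have r: "Well_order r"
    unfolding r_def by (rule Well_order_dir_image[OF Well_order_class]) (use g in \<open>auto simp: inj_on_def\<close>)
  have r_iff: "(g x, g y) \<in> r \<longleftrightarrow> x \<le> y" for x y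
    using g by (auto simp: r_def dir_image_def inj_on_def)
  have Field_r: "Field r = range g"
    unfolding r_def dir_image_Field by (auto simp: Field_def)
  have underS_s: "underS r (g x) = g ` {..<x}" for x
  proof -
    have "underS r (g x) \<subseteq> range g"
      unfolding Field_r[symmetric] by (auto simp: underS_def Field_def)
    then have "underS r (g x) = g ` {y. g y \<in> underS r (g x)}" by blast
    also have "{y. g y \<in> underS r (g x)} = {..<x}"
      using g by (auto simp: underS_def r_iff le_less dest: injD)
    finally show ?thesis .
  qed
  define s where "s x = Restr r (underS r (g x))" for x
  have s_r: "(s x, r) \<in> ordLess" for x
    unfolding s_def using underS_Restr_ordLess[OF r] Field_r by blast
  have s_s: "(s x, s y) \<in> ordLess" if "x < y" for x y
  proof -
    have "underS r (g x) \<subset> underS r (g y)"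
      unfolding underS_s by (rule image_strict_mono[OF inj_on_subset[OF g subset_UNIV]]) (use that in auto)
    then show ?thesis
      unfolding s_def using ofilter_subset_ordLess[OF r] wo_rel.underS_ofilter r
      by (metis wo_rel_def)
  qed
  have s_wo: "(s x, s x) \<in> ordIso" for x
    using s_r[of x] by (auto simp: ordIso_refl_iff ordLess_def)
  have r_wo: "(r, r) \<in> ordIso" using r by (simp add: ordIso_refl_iff)
  define h where "h x = abs_ordinal (s x)" for x
  have h_mono: "h x < h y" if "x < y" for x y
    using s_s[OF that] by (simp add: h_def less_ordinal.abs_eq s_wo)
  have h: "x \<le> h x" for x
  proof (induction x rule: less_induct)
    case (less x)
    show ?case
    proof (rule ccontr)
      assume "\<not> x \<le> h x"
      then show False
        using less.IH[of "h x"] h_mono[of "h x" x] by (simp add: not_le)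
    qed
  qed
  have "h x < abs_ordinal r" for x
    using s_r[of x] by (simp add: h_def less_ordinal.abs_eq s_wo r_wo)
  with h show False by (meson leD)
qed

text \<open>Without a strict bound, every ordinal would be at most some member of \<open>S\<close>.
  All ordinals would then form a union of few small sets and inject into \<open>'a + nat\<close>,
  against \<open>not_inj_ordinal\<close>.\<close>

lemma small_set_bounded:
  fixes S :: "'a ordinal set"
  assumes "(card_of S, card_of (UNIV :: ('a + nat) set)) \<in> ordLeq"
  shows "\<exists>\<gamma>. \<forall>s\<in>S. s < \<gamma>"
proof (rule ccontr)
  assume "\<not> ?thesis"
  then have "(UNIV :: 'a ordinal set) = (\<Union>s\<in>S. {..<s} \<union> {s})"
    by (force simp: not_less le_less)
  moreover have "(card_of (\<Union>s\<in>S. {..<s} \<union> {s}), card_of (UNIV :: ('a + nat) set)) \<in> ordLeq"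
  proof (intro card_of_UNION_ordLeq_infinite[OF infinite_UNIV_sum_nat assms] ballI
      card_of_Un_ordLeq_infinite_Field card_of_lessThan_ordinal card_of_Card_order)
    show "infinite (Field (card_of (UNIV :: ('a + nat) set)))"
      unfolding Field_card_of by (rule infinite_UNIV_sum_nat)
    show "(card_of {s}, card_of (UNIV :: ('a + nat) set)) \<in> ordLeq" for s :: "'a ordinal"
      by (rule card_of_singl_ordLeq) simp
  qed
  ultimately show False
    using not_inj_ordinal card_of_ordLeq by metis
qed

text \<open>Provides candidates for \<open>LEAST\<close> in the recursions for sums, products and
  powers, so that the least one exists and has the required property.\<close>

lemma lessThan_image_bounded: "\<exists>\<gamma>. \<forall>\<beta>'<\<beta>. f \<beta>' < (\<gamma> :: 'a ordinal)" for \<beta> :: "'a ordinal"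
  using small_set_bounded[of "f ` {..<\<beta>}"]
    ordLeq_transitive[OF card_of_image card_of_lessThan_ordinal, of f \<beta>]
  by auto

lemma range_nat_bounded: "\<exists>\<gamma>. \<forall>n::nat. f n < (\<gamma> :: 'a ordinal)"
proof -
  have "(card_of (UNIV :: nat set), card_of (UNIV :: ('a + nat) set)) \<in> ordLeq"
    by (rule card_of_ordLeq[THEN iffD1]) (auto intro!: exI[of _ Inr])
  then show ?thesis
    using small_set_bounded[of "range f"] ordLeq_transitive[OF card_of_image, of UNIV _ f]
    by auto
qed

section \<open>Ordinal arithmetic\<close>

lemma ord_zero_le [simp]: "ord_zero \<le> \<alpha>"
  unfolding ord_zero_def by (rule Least_le) simp

lemma not_less_ord_zero [simp]: "\<not> \<alpha> < ord_zero"
  by (simp add: not_less)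

lemma le_ord_zero_iff [simp]: "\<alpha> \<le> ord_zero \<longleftrightarrow> \<alpha> = ord_zero"
  by (auto intro: antisym)

lemma less_ord_succ: "\<alpha> < ord_succ \<alpha>"
proof -
  \<comment> \<open>A strict bound of a constant sequence exceeds its value.\<close>
  obtain \<gamma> where "\<alpha> < \<gamma>" using range_nat_bounded[of "\<lambda>_. \<alpha>"] by blast
  then show ?thesis unfolding ord_succ_def by (rule LeastI)
qed

lemma ord_succ_le_iff: "ord_succ \<alpha> \<le> \<beta> \<longleftrightarrow> \<alpha> < \<beta>"
proof
  assume "\<alpha> < \<beta>"
  then show "ord_succ \<alpha> \<le> \<beta>" unfolding ord_succ_def by (rule Least_le)
qed (rule less_le_trans[OF less_ord_succ])

lemma less_ord_succ_iff: "\<beta> < ord_succ \<alpha> \<longleftrightarrow> \<beta> \<le> \<alpha>"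
  by (metis ord_succ_le_iff not_less)

lemma ord_of_nat_strict_mono: "strict_mono (ord_of_nat :: nat \<Rightarrow> 'a ordinal)"
  by (simp add: strict_mono_Suc_iff less_ord_succ)

lemma ord_of_nat_less_omega: "ord_of_nat n < ord_omega"
  using LeastI_ex[OF range_nat_bounded[of ord_of_nat]] unfolding ord_omega_def by blast

lemma ord_omega_le_iff: "ord_omega \<le> \<gamma> \<longleftrightarrow> (\<forall>n. ord_of_nat n < \<gamma>)"
proof
  assume "\<forall>n. ord_of_nat n < \<gamma>"
  then show "ord_omega \<le> \<gamma>" unfolding ord_omega_def by (rule Least_le)
qed (simp add: less_le_trans[OF ord_of_nat_less_omega])

lemma le_ord_of_natD: "\<alpha> \<le> ord_of_nat n \<Longrightarrow> \<exists>m\<le>n. \<alpha> = ord_of_nat m"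
proof (induction n)
  case (Suc n)
  then consider "\<alpha> = ord_of_nat (Suc n)" | "\<alpha> \<le> ord_of_nat n"
    by (auto simp: le_less[of \<alpha> "ord_succ _"] less_ord_succ_iff)
  then show ?case
    using Suc.IH le_SucI by cases blast+
qed simp

lemma less_ord_omega_iff: "\<alpha> < ord_omega \<longleftrightarrow> (\<exists>n. \<alpha> = ord_of_nat n)"
  using ord_omega_le_iff[of \<alpha>] le_ord_of_natD[of \<alpha>] ord_of_nat_less_omega
  by (meson not_less)

text \<open>The maximum of \<alpha> and a bound of the earlier sums is a candidate, so
  \<open>LEAST\<close> meets its own specification. Together with \<open>ord_add_leI\<close> this
  replaces the recursion equation.\<close>

lemma ord_add_ge_left: "\<alpha> \<le> ord_add \<alpha> \<beta>"
  and ord_add_strict_mono: "\<beta>' < \<beta> \<Longrightarrow> ord_add \<alpha> \<beta>' < ord_add \<alpha> \<beta>"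
proof -
  obtain \<gamma> where \<gamma>: "\<forall>\<beta>'<\<beta>. ord_add \<alpha> \<beta>' < \<gamma>" using lessThan_image_bounded[of \<beta> "ord_add \<alpha>"] by auto
  have "\<alpha> \<le> max \<alpha> \<gamma> \<and> (\<forall>\<beta>'. \<beta>' < \<beta> \<longrightarrow> ord_add \<alpha> \<beta>' < max \<alpha> \<gamma>)"
    using \<gamma> by (auto simp: less_max_iff_disj)
  from LeastI[of "\<lambda>\<gamma>. \<alpha> \<le> \<gamma> \<and> (\<forall>\<beta>'. \<beta>' < \<beta> \<longrightarrow> ord_add \<alpha> \<beta>' < \<gamma>)", OF this]
  show "\<alpha> \<le> ord_add \<alpha> \<beta>" "\<beta>' < \<beta> \<Longrightarrow> ord_add \<alpha> \<beta>' < ord_add \<alpha> \<beta>"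
    by (simp_all add: ord_add.simps[of \<alpha> \<beta>])
qed

lemma ord_add_leI: "\<alpha> \<le> \<gamma> \<Longrightarrow> (\<And>\<beta>'. \<beta>' < \<beta> \<Longrightarrow> ord_add \<alpha> \<beta>' < \<gamma>) \<Longrightarrow> ord_add \<alpha> \<beta> \<le> \<gamma>"
  unfolding ord_add.simps[of \<alpha> \<beta>] by (rule Least_le) simp

lemma ord_add_less_iff [simp]: "ord_add \<alpha> \<beta> < ord_add \<alpha> \<gamma> \<longleftrightarrow> \<beta> < \<gamma>"
  using ord_add_strict_mono by (metis linorder_neqE not_less_iff_gr_or_eq)

lemma ord_add_le_iff [simp]: "ord_add \<alpha> \<beta> \<le> ord_add \<alpha> \<gamma> \<longleftrightarrow> \<beta> \<le> \<gamma>"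
  by (simp flip: not_less)

text \<open>Addition of a fixed left summand is strictly increasing, and such a self-map of a
  well-order stays above the identity.\<close>

lemma ord_add_ge_right: "\<beta> \<le> ord_add \<alpha> \<beta>"
proof (induction \<beta> rule: less_induct)
  case (less \<beta>)
  show ?case
  proof (rule ccontr)
    assume "\<not> \<beta> \<le> ord_add \<alpha> \<beta>"
    then show False
      using less[of "ord_add \<alpha> \<beta>"] ord_add_strict_mono[of "ord_add \<alpha> \<beta>" \<beta> \<alpha>] by (simp add: not_le)
  qed
qed

lemma ord_add_zero [simp]: "ord_add \<alpha> ord_zero = \<alpha>"
  by (rule antisym) (auto intro: ord_add_leI ord_add_ge_left)

lemma ord_zero_add [simp]: "ord_add ord_zero \<beta> = \<beta>"
proof (induction \<beta> rule: less_induct)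
  case (less \<beta>)
  show ?case by (rule antisym) (auto intro: ord_add_leI ord_add_ge_right simp: less)
qed

lemma ord_add_succ: "ord_add \<alpha> (ord_succ \<beta>) = ord_succ (ord_add \<alpha> \<beta>)"
proof (rule antisym)
  show "ord_add \<alpha> (ord_succ \<beta>) \<le> ord_succ (ord_add \<alpha> \<beta>)"
    by (rule ord_add_leI)
      (auto simp: less_ord_succ_iff intro: less_imp_le le_less_trans[OF ord_add_ge_left] less_ord_succ)
qed (simp add: ord_succ_le_iff less_ord_succ)

lemma ord_add_diff: "\<alpha> \<le> \<gamma> \<Longrightarrow> \<exists>\<beta>. \<gamma> = ord_add \<alpha> \<beta>"
proof -
  assume "\<alpha> \<le> \<gamma>"
  \<comment> \<open>With the least \<beta> whose sum reaches \<gamma>, all earlier sums stay below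
    \<gamma>, so \<open>ord_add_leI\<close> gives the reverse inequality.\<close>
  define \<beta> where "\<beta> = (LEAST \<beta>. \<gamma> \<le> ord_add \<alpha> \<beta>)"
  have "\<gamma> \<le> ord_add \<alpha> \<beta>"
    unfolding \<beta>_def by (rule LeastI) (rule ord_add_ge_right)
  moreover have "ord_add \<alpha> \<beta> \<le> \<gamma>"
    using \<open>\<alpha> \<le> \<gamma>\<close> by (intro ord_add_leI) (auto simp: \<beta>_def not_le dest: not_less_Least)
  ultimately show ?thesis by (blast intro: antisym)
qed

section \<open>Ordinal multiplication\<close>

lemma ord_mult_ge: "\<beta>' < \<beta> \<Longrightarrow> ord_add (ord_mult \<alpha> \<beta>') \<alpha> \<le> ord_mult \<alpha> \<beta>"
proof -
  obtain \<gamma> where "\<forall>\<beta>'<\<beta>. ord_add (ord_mult \<alpha> \<beta>') \<alpha> < \<gamma>"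
    using lessThan_image_bounded[of \<beta> "\<lambda>\<beta>'. ord_add (ord_mult \<alpha> \<beta>') \<alpha>"] by auto
  then have "\<forall>\<beta>'. \<beta>' < \<beta> \<longrightarrow> ord_add (ord_mult \<alpha> \<beta>') \<alpha> \<le> \<gamma>" by auto
  from LeastI[of "\<lambda>\<gamma>. \<forall>\<beta>'. \<beta>' < \<beta> \<longrightarrow> ord_add (ord_mult \<alpha> \<beta>') \<alpha> \<le> \<gamma>", OF this]
  show "\<beta>' < \<beta> \<Longrightarrow> ord_add (ord_mult \<alpha> \<beta>') \<alpha> \<le> ord_mult \<alpha> \<beta>"
    by (simp add: ord_mult.simps[of \<alpha> \<beta>])
qed

lemma ord_mult_leI:
  "(\<And>\<beta>'. \<beta>' < \<beta> \<Longrightarrow> ord_add (ord_mult \<alpha> \<beta>') \<alpha> \<le> \<gamma>) \<Longrightarrow> ord_mult \<alpha> \<beta> \<le> \<gamma>"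
  unfolding ord_mult.simps[of \<alpha> \<beta>] by (rule Least_le) simp

lemma ord_mult_zero [simp]: "ord_mult \<alpha> ord_zero = ord_zero"
  using ord_mult_leI[of ord_zero \<alpha> ord_zero] by simp

lemma ord_mult_mono: "\<beta> \<le> \<gamma> \<Longrightarrow> ord_mult \<alpha> \<beta> \<le> ord_mult \<alpha> \<gamma>"
  by (rule ord_mult_leI) (rule ord_mult_ge, rule less_le_trans)

lemma ord_mult_succ: "ord_mult \<alpha> (ord_succ \<beta>) = ord_add (ord_mult \<alpha> \<beta>) \<alpha>"
proof (rule antisym)
  show "ord_mult \<alpha> (ord_succ \<beta>) \<le> ord_add (ord_mult \<alpha> \<beta>) \<alpha>"
  proof (rule ord_mult_leI)
    fix \<beta>' assume "\<beta>' < ord_succ \<beta>"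
    then consider "\<beta>' = \<beta>" | "\<beta>' < \<beta>" by (auto simp: less_ord_succ_iff le_less)
    then show "ord_add (ord_mult \<alpha> \<beta>') \<alpha> \<le> ord_add (ord_mult \<alpha> \<beta>) \<alpha>"
      by cases (auto intro: order_trans[OF ord_mult_ge ord_add_ge_left])
  qed
qed (simp add: ord_mult_ge less_ord_succ)

lemma ord_one_mult_nat: "ord_mult (ord_of_nat 1) (ord_of_nat n) = ord_of_nat n"
  by (induction n) (simp_all add: ord_mult_succ ord_add_succ)

section \<open>Powers of \<omega>\<close>

lemma omega_power_ge_one: "ord_of_nat 1 \<le> omega_power \<beta>"
  and omega_power_ge: "\<beta>' < \<beta> \<Longrightarrow> ord_mult (omega_power \<beta>') ord_omega \<le> omega_power \<beta>"
proof -
  obtain \<gamma> where \<gamma>: "\<forall>\<beta>'<\<beta>. ord_mult (omega_power \<beta>') ord_omega < \<gamma>"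
    using lessThan_image_bounded[of \<beta> "\<lambda>\<beta>'. ord_mult (omega_power \<beta>') ord_omega"] by auto
  have "ord_of_nat 1 \<le> max (ord_of_nat 1) \<gamma> \<and>
      (\<forall>\<beta>'. \<beta>' < \<beta> \<longrightarrow> ord_mult (omega_power \<beta>') ord_omega \<le> max (ord_of_nat 1) \<gamma>)"
    using \<gamma> by (auto simp: le_max_iff_disj intro: less_imp_le)
  from LeastI[of "\<lambda>\<gamma>. ord_of_nat 1 \<le> \<gamma> \<and>
    (\<forall>\<beta>'. \<beta>' < \<beta> \<longrightarrow> ord_mult (omega_power \<beta>') ord_omega \<le> \<gamma>)", OF this]
  show "ord_of_nat 1 \<le> omega_power \<beta>"
    "\<beta>' < \<beta> \<Longrightarrow> ord_mult (omega_power \<beta>') ord_omega \<le> omega_power \<beta>"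
    unfolding omega_power.simps[of \<beta>] by blast+
qed

lemma omega_power_leI:
  assumes "ord_of_nat 1 \<le> \<gamma>"
    and "\<And>\<beta>'. \<beta>' < \<beta> \<Longrightarrow> ord_mult (omega_power \<beta>') ord_omega \<le> \<gamma>"
  shows "omega_power \<beta> \<le> \<gamma>"
  unfolding omega_power.simps[of \<beta>] by (rule Least_le) (use assms in blast)

lemma omega_power_pos: "ord_zero < omega_power \<beta>"
  using omega_power_ge_one[of \<beta>] by (simp add: ord_succ_le_iff)

lemma omega_power_zero: "omega_power ord_zero = ord_of_nat 1"
  by (intro antisym omega_power_leI omega_power_ge_one) simp_all

text \<open>There is always room for one more copy of the smaller power below its product with
  \<omega>, which makes the inequality strict.\<close>

lemma omega_power_mult_nat_less:
  assumes "\<zeta> < \<eta>"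
  shows "ord_mult (omega_power \<zeta>) (ord_of_nat n) < omega_power \<eta>"
proof -
  let ?w = "omega_power \<zeta>"
  have "ord_add (ord_mult ?w (ord_of_nat n)) ord_zero < ord_add (ord_mult ?w (ord_of_nat n)) ?w"
    by (simp only: ord_add_less_iff omega_power_pos)
  also have "\<dots> \<le> ord_mult ?w ord_omega"
    by (rule ord_mult_ge[OF ord_of_nat_less_omega])
  also have "\<dots> \<le> omega_power \<eta>"
    by (rule omega_power_ge[OF assms])
  finally show ?thesis by simp
qed

lemma ord_mult_one [simp]: "ord_mult \<alpha> (ord_succ ord_zero) = \<alpha>"
  by (simp add: ord_mult_succ)

lemma omega_power_strict_mono: "\<zeta> < \<eta> \<Longrightarrow> omega_power \<zeta> < omega_power \<eta>"
  using omega_power_mult_nat_less[of \<zeta> \<eta> 1] by simp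

lemma le_omega_power: "\<zeta> \<le> omega_power \<zeta>"
proof (induction \<zeta> rule: less_induct)
  case (less \<zeta>)
  show ?case
  proof (rule ccontr)
    assume "\<not> \<zeta> \<le> omega_power \<zeta>"
    then show False
      using less[of "omega_power \<zeta>"] omega_power_strict_mono[of "omega_power \<zeta>" \<zeta>]
      by (simp add: not_le)
  qed
qed

text \<open>Otherwise \<alpha> bounds all finite multiples of all smaller powers, hence their
  products with \<omega>, and so the power at \<eta> itself. The assumption
  \<open>ord_of_nat 1 \<le> \<alpha>\<close> handles the lower bound 1 in the recursion.\<close>

lemma less_omega_powerD:
  fixes \<alpha> \<eta> :: "'a ordinal"
  assumes "ord_of_nat 1 \<le> \<alpha>" and "\<alpha> < omega_power \<eta>"
  shows "\<exists>\<zeta><\<eta>. \<exists>n. \<alpha> < ord_mult (omega_power \<zeta>) (ord_of_nat n)"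
proof (rule ccontr)
  assume *: "\<not> ?thesis"
  have "omega_power \<eta> \<le> \<alpha>"
  proof (rule omega_power_leI[OF assms(1)], rule ord_mult_leI)
    fix \<zeta> \<beta>' :: "'a ordinal" assume "\<zeta> < \<eta>" and "\<beta>' < ord_omega"
    then obtain n where "\<beta>' = ord_of_nat n" by (auto simp: less_ord_omega_iff)
    then show "ord_add (ord_mult (omega_power \<zeta>) \<beta>') (omega_power \<zeta>) \<le> \<alpha>"
      using * \<open>\<zeta> < \<eta>\<close> ord_mult_succ[of "omega_power \<zeta>" \<beta>']
      by (metis not_less ord_of_nat.simps(2))
  qed
  with assms(2) show False by simp
qed

text \<open>Splits off the leading term of the normal form: \<zeta> is the leading exponent,
  \<open>c\<close> its coefficient and \<rho> the rest.\<close>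

lemma omega_power_division:
  assumes "\<alpha> \<noteq> ord_zero"
  obtains \<zeta> c \<rho> where "0 < c" "\<rho> < omega_power \<zeta>" "omega_power \<zeta> \<le> \<alpha>"
    "\<alpha> = ord_add (ord_mult (omega_power \<zeta>) (ord_of_nat c)) \<rho>"
proof -
  have "ord_of_nat 1 \<le> \<alpha>"
    using assms by (simp add: ord_succ_le_iff flip: not_le)
  define \<eta> where "\<eta> = (LEAST \<eta>. \<alpha> < omega_power \<eta>)"
  have "\<alpha> < omega_power (ord_succ \<alpha>)"
    using le_omega_power less_ord_succ by (rule le_less_trans[OF _ omega_power_strict_mono])
  then have "\<alpha> < omega_power \<eta>" unfolding \<eta>_def by (rule LeastI)
  then obtain \<zeta> n where "\<zeta> < \<eta>" and n: "\<alpha> < ord_mult (omega_power \<zeta>) (ord_of_nat n)"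
    using less_omega_powerD \<open>ord_of_nat 1 \<le> \<alpha>\<close> by blast
  \<comment> \<open>Since \<zeta> is below the least exponent whose power exceeds \<alpha>, its own
    power does not exceed \<alpha>.\<close>
  then have \<zeta>: "omega_power \<zeta> \<le> \<alpha>"
    unfolding \<eta>_def by (auto dest: not_less_Least simp: not_less)
  \<comment> \<open>The first multiple that overshoots \<alpha>; the coefficient \<open>c\<close> is
    one less, which keeps the remainder below the power.\<close>
  define m where "m = (LEAST m. \<alpha> < ord_mult (omega_power \<zeta>) (ord_of_nat m))"
  have m: "\<alpha> < ord_mult (omega_power \<zeta>) (ord_of_nat m)"
    using n unfolding m_def by (rule LeastI)
  then have "m \<noteq> 0" by (metis not_less_ord_zero ord_mult_zero ord_of_nat.simps(1))
  then obtain c where c: "m = Suc c" using not0_implies_Suc by blast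
  have "ord_mult (omega_power \<zeta>) (ord_of_nat c) \<le> \<alpha>"
    using not_less_Least[of c "\<lambda>m. \<alpha> < ord_mult (omega_power \<zeta>) (ord_of_nat m)"]
    by (simp add: c not_less flip: m_def)
  then obtain \<rho> where \<rho>: "\<alpha> = ord_add (ord_mult (omega_power \<zeta>) (ord_of_nat c)) \<rho>"
    using ord_add_diff by blast
  have less: "\<rho> < omega_power \<zeta>"
    using m unfolding \<rho> c by (simp add: ord_mult_succ)
  have "c \<noteq> 0"
  proof
    assume "c = 0"
    with \<rho> less \<zeta> show False by simp
  qed
  with less \<zeta> \<rho> that show thesis by blast
qed

section \<open>Existence and uniqueness of Cantor normal forms\<close>

text \<open>Reads coefficients off arbitrary lists, so that normal forms can be compared by list
  induction before \<open>cnf\<close>, a definite description, is known to be well defined.\<close>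

definition list_coeff :: "('a ordinal \<times> nat) list \<Rightarrow> 'a ordinal \<Rightarrow> nat"
  where "list_coeff xs \<zeta> = (case map_of xs \<zeta> of None \<Rightarrow> 0 | Some c \<Rightarrow> c)"

lemma cnf_value_Nil [simp]: "cnf_value [] = ord_zero"
  and cnf_value_Cons [simp]: "cnf_value ((\<zeta>, c) # xs) =
    ord_add (ord_mult (omega_power \<zeta>) (ord_of_nat c)) (cnf_value xs)"
  by (simp_all add: cnf_value_def)

lemma is_cnf_Nil [simp]: "is_cnf []"
  and is_cnf_Cons [simp]: "is_cnf ((\<zeta>, c) # xs) \<longleftrightarrow>
    (\<forall>\<eta>\<in>fst ` set xs. \<eta> < \<zeta>) \<and> 0 < c \<and> is_cnf xs"
  by (auto simp: is_cnf_def)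

lemma list_coeff_Nil [simp]: "list_coeff [] \<zeta> = 0"
  and list_coeff_Cons: "list_coeff ((\<eta>, c) # xs) \<zeta> = (if \<zeta> = \<eta> then c else list_coeff xs \<zeta>)"
  by (simp_all add: list_coeff_def)

lemma list_coeff_pos_iff: "is_cnf xs \<Longrightarrow> 0 < list_coeff xs \<zeta> \<longleftrightarrow> \<zeta> \<in> fst ` set xs"
proof (induction xs)
  case (Cons x xs)
  then show ?case by (cases x) (auto simp: list_coeff_Cons)
qed simp

lemma list_coeff_nonzero: "is_cnf xs \<Longrightarrow> {\<zeta>. list_coeff xs \<zeta> \<noteq> 0} = fst ` set xs"
  by (simp add: list_coeff_pos_iff)

lemma list_coeff_eq_0: "\<zeta> \<notin> fst ` set xs \<Longrightarrow> list_coeff xs \<zeta> = 0"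
  by (simp add: list_coeff_def map_of_eq_None_iff[THEN iffD2])

lemma omega_power_le_cnf_value:
  assumes "is_cnf ((\<zeta>, c) # xs)"
  shows "omega_power \<zeta> \<le> cnf_value ((\<zeta>, c) # xs)"
proof -
  have "ord_of_nat 1 \<le> ord_of_nat c"
    using assms strict_mono_less_eq[OF ord_of_nat_strict_mono, of 1 c] by (simp add: Suc_le_eq)
  then have "ord_mult (omega_power \<zeta>) (ord_of_nat 1) \<le> ord_mult (omega_power \<zeta>) (ord_of_nat c)"
    by (rule ord_mult_mono)
  also have "\<dots> \<le> cnf_value ((\<zeta>, c) # xs)"
    by (simp add: ord_add_ge_left)
  finally show ?thesis by simp
qed

text \<open>By induction the tail is below the leading power, so raising the leading coefficient by
  one bounds the whole value; that multiple is still below the power at \<eta>.\<close>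

lemma cnf_value_less_omega_power:
  "is_cnf xs \<Longrightarrow> \<forall>\<zeta>\<in>fst ` set xs. \<zeta> < \<eta> \<Longrightarrow> cnf_value xs < omega_power \<eta>"
proof (induction xs arbitrary: \<eta>)
  case Nil
  then show ?case by (simp add: omega_power_pos)
next
  case (Cons x xs)
  obtain \<zeta> c where x: "x = (\<zeta>, c)" by fastforce
  have "cnf_value (x # xs) < ord_mult (omega_power \<zeta>) (ord_of_nat (Suc c))"
    using Cons.IH[of \<zeta>] Cons.prems by (simp add: x ord_mult_succ)
  also have "\<dots> < omega_power \<eta>"
    by (rule omega_power_mult_nat_less) (use Cons.prems x in simp)
  finally show ?case .
qed

text \<open>Induction applies to the remainder of the division because it is below the leading
  power, hence below \<alpha>. For the same reason its exponents are below \<zeta>.\<close>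

lemma cnf_exists: "\<exists>xs. is_cnf xs \<and> cnf_value xs = \<alpha>"
proof (induction \<alpha> rule: less_induct)
  case (less \<alpha>)
  show ?case
  proof (cases "\<alpha> = ord_zero")
    case True
    then show ?thesis by (intro exI[of _ "[]"]) simp
  next
    case False
    then obtain \<zeta> c \<rho> where \<zeta>: "0 < c" "\<rho> < omega_power \<zeta>" "omega_power \<zeta> \<le> \<alpha>"
      "\<alpha> = ord_add (ord_mult (omega_power \<zeta>) (ord_of_nat c)) \<rho>"
      by (rule omega_power_division)
    then obtain xs where xs: "is_cnf xs" "cnf_value xs = \<rho>"
      using less.IH[OF less_le_trans] by blast
    have "\<eta> < \<zeta>" if "\<eta> \<in> fst ` set xs" for \<eta>
    proof (cases xs)
      case Nil
      with that show ?thesis by simp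
    next
      case (Cons y ys)
      obtain \<theta> d where y: "y = (\<theta>, d)" by fastforce
      have "\<theta> < \<zeta>"
      proof (rule ccontr)
        assume "\<not> \<theta> < \<zeta>"
        then have "omega_power \<zeta> \<le> omega_power \<theta>"
          using omega_power_strict_mono[of \<zeta> \<theta>] by (auto simp: not_less le_less)
        also have "\<dots> \<le> \<rho>"
          using omega_power_le_cnf_value[of \<theta> d ys] xs by (simp add: Cons y)
        finally show False using \<zeta>(2) by simp
      qed
      moreover have "\<eta> \<le> \<theta>"
        using that xs(1) by (auto simp: Cons y intro: less_imp_le)
      ultimately show ?thesis by simp
    qed
    then have "is_cnf ((\<zeta>, c) # xs)"
      using xs(1) \<zeta>(1) by simp
    moreover have "cnf_value ((\<zeta>, c) # xs) = \<alpha>"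
      using xs(2) \<zeta>(4) by simp
    ultimately show ?thesis by blast
  qed
qed

text \<open>Here \<theta> is the largest exponent at which the coefficients differ. The induction
  compares leading terms and strips them as long as they agree.\<close>

lemma cnf_value_less:
  assumes "is_cnf xs" "is_cnf ys" "list_coeff xs \<theta> < list_coeff ys \<theta>"
    and "\<And>\<zeta>. \<theta> < \<zeta> \<Longrightarrow> list_coeff xs \<zeta> = list_coeff ys \<zeta>"
  shows "cnf_value xs < cnf_value ys"
  using assms
proof (induction xs arbitrary: ys)
  case Nil
  then obtain \<eta> d ys' where "ys = (\<eta>, d) # ys'"
    by (cases ys) auto
  then show ?case
    using omega_power_le_cnf_value[of \<eta> d ys'] Nil.prems(2) omega_power_pos[of \<eta>]
    by (simp del: cnf_value_Cons)
next
  case (Cons x xs)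
  obtain \<zeta> c where x: "x = (\<zeta>, c)" by fastforce
  obtain \<eta> d ys' where ys: "ys = (\<eta>, d) # ys'"
    using Cons.prems(3) by (cases ys) auto
  have \<theta>: "\<theta> \<le> \<eta>"
    using Cons.prems(2,3) list_coeff_eq_0[of \<theta> ys] by (auto simp: ys intro: less_imp_le)
  have xs: "is_cnf xs" "\<forall>\<xi>\<in>fst ` set xs. \<xi> < \<zeta>" "0 < c"
    and ys': "is_cnf ys'" "\<forall>\<xi>\<in>fst ` set ys'. \<xi> < \<eta>" "0 < d"
    using Cons.prems(1,2) by (auto simp: x ys)
  consider "\<eta> < \<zeta>" | "\<zeta> < \<eta>" | "\<zeta> = \<eta>" by fastforce
  then show ?case
  proof cases
    \<comment> \<open>Impossible: \<zeta> lies above \<theta> and has a positive coefficient on the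
      left but none on the right.\<close>
    case 1
    then have "list_coeff ys \<zeta> = 0"
      using ys'(2) by (intro list_coeff_eq_0) (auto simp: ys dest: bspec)
    moreover have "list_coeff (x # xs) \<zeta> = list_coeff ys \<zeta>"
      using 1 \<theta> by (intro Cons.prems(4)) simp
    ultimately show ?thesis using xs(3) by (simp add: x list_coeff_Cons)
  next
    case 2
    have "cnf_value (x # xs) < omega_power \<eta>"
      using Cons.prems(1) 2 xs(2) by (intro cnf_value_less_omega_power) (auto simp: x)
    also have "\<dots> \<le> cnf_value ys"
      using omega_power_le_cnf_value[of \<eta> d ys'] Cons.prems(2) by (simp add: ys)
    finally show ?thesis .
  next
    case 3
    show ?thesis
    proof (cases "\<theta> = \<eta>")
      case True
      then have "ord_of_nat (Suc c) \<le> (ord_of_nat d :: 'a ordinal)"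
        using Cons.prems(3) strict_mono_less_eq[OF ord_of_nat_strict_mono, of "Suc c" d]
        by (simp add: x ys 3 list_coeff_Cons Suc_le_eq)
      have "cnf_value (x # xs) < ord_mult (omega_power \<zeta>) (ord_of_nat (Suc c))"
        using cnf_value_less_omega_power[OF xs(1,2)] by (simp add: x ord_mult_succ)
      also have "\<dots> \<le> ord_mult (omega_power \<zeta>) (ord_of_nat d)"
        by (rule ord_mult_mono) fact
      also have "\<dots> \<le> cnf_value ys"
        by (simp add: ys 3 ord_add_ge_left)
      finally show ?thesis .
    next
      case False
      with \<theta> have "\<theta> < \<eta>" by simp
      \<comment> \<open>The heads hide the tails' coefficients at \<eta>; both are 0 there, so the
        tails too agree above \<theta>.\<close>
      have tails: "list_coeff xs \<eta> = 0" "list_coeff ys' \<eta> = 0"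
        using xs(2) ys'(2) 3 by (auto intro!: list_coeff_eq_0)
      have "c = d"
        using Cons.prems(4)[OF \<open>\<theta> < \<eta>\<close>] by (simp add: x ys 3 list_coeff_Cons)
      moreover have "cnf_value xs < cnf_value ys'"
      proof (rule Cons.IH[OF xs(1) ys'(1)])
        show "list_coeff xs \<theta> < list_coeff ys' \<theta>"
          using Cons.prems(3) False by (simp add: x ys 3 list_coeff_Cons)
        show "list_coeff xs \<xi> = list_coeff ys' \<xi>" if "\<theta> < \<xi>" for \<xi>
          using Cons.prems(4)[OF that] tails by (auto simp: x ys 3 list_coeff_Cons split: if_splits)
      qed
      ultimately show ?thesis by (simp add: x ys 3)
    qed
  qed
qed

text \<open>A normal form is recovered from its coefficient function by listing the support in
  decreasing order. Hence equal coefficients force equal lists, and \<open>ord_of_coeffs\<close>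
  inverts \<open>cnf_coeff\<close>.\<close>

lemma cnf_eq_map:
  assumes "is_cnf xs"
  shows "xs = map (\<lambda>\<zeta>. (\<zeta>, list_coeff xs \<zeta>)) (rev (sorted_list_of_set {\<zeta>. list_coeff xs \<zeta> \<noteq> 0}))"
proof -
  have sorted: "sorted_wrt (<) (rev (map fst xs))"
    using assms by (simp add: is_cnf_def sorted_wrt_rev)
  have "sorted_list_of_set (set (rev (map fst xs))) = rev (map fst xs)"
    using sorted by (intro sorted_list_of_set.idem_if_sorted_distinct)
      (auto simp: strict_sorted_iff)
  then have "rev (sorted_list_of_set {\<zeta>. list_coeff xs \<zeta> \<noteq> 0}) = map fst xs"
    using list_coeff_nonzero[OF assms] by simp
  moreover have "distinct (map fst xs)"
    using sorted by (simp add: strict_sorted_iff)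
  then have "map (\<lambda>\<zeta>. (\<zeta>, list_coeff xs \<zeta>)) (map fst xs) = xs"
    by (auto simp: list_coeff_def intro!: map_idI)
  ultimately show ?thesis by simp
qed

lemma
  assumes "finite {\<zeta>. c \<zeta> \<noteq> 0}"
  defines "xs \<equiv> map (\<lambda>\<zeta>. (\<zeta>, c \<zeta>)) (rev (sorted_list_of_set {\<zeta>. c \<zeta> \<noteq> 0}))"
  shows is_cnf_map: "is_cnf xs" and list_coeff_map: "list_coeff xs = c"
proof -
  have "sorted_wrt (<) (sorted_list_of_set {\<zeta>. c \<zeta> \<noteq> 0})"
    by (rule strict_sorted_list_of_set)
  then show "is_cnf xs"
    using assms(1) by (auto simp: is_cnf_def xs_def sorted_wrt_rev comp_def)
  show "list_coeff xs = c"
    using assms(1) by (auto simp: xs_def list_coeff_def map_of_map_restrict restrict_map_def)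
qed

text \<open>If the coefficients differed, finiteness of the supports would give a largest
  difference, and \<open>cnf_value_less\<close> would separate the values.\<close>

lemma is_cnf_unique:
  assumes "is_cnf xs" "is_cnf ys" "cnf_value xs = cnf_value ys"
  shows "xs = ys"
proof -
  let ?D = "{\<zeta>. list_coeff xs \<zeta> \<noteq> list_coeff ys \<zeta>}"
  have "?D = {}"
  proof (rule ccontr)
    assume ne: "?D \<noteq> {}"
    have "?D \<subseteq> {\<zeta>. list_coeff xs \<zeta> \<noteq> 0} \<union> {\<zeta>. list_coeff ys \<zeta> \<noteq> 0}" by auto
    then have fin: "finite ?D"
      by (rule finite_subset) (simp add: list_coeff_pos_iff assms)
    define \<theta> where "\<theta> = Max ?D"
    have \<theta>: "list_coeff xs \<theta> \<noteq> list_coeff ys \<theta>"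
      using Max_in[OF fin ne] by (simp add: \<theta>_def)
    have above: "list_coeff xs \<zeta> = list_coeff ys \<zeta>" if "\<theta> < \<zeta>" for \<zeta>
      using Max_ge[OF fin, of \<zeta>] that by (auto simp: not_le[symmetric] \<theta>_def)
    have "cnf_value xs < cnf_value ys \<or> cnf_value ys < cnf_value xs"
      using \<theta> above cnf_value_less[OF assms(1,2)] cnf_value_less[OF assms(2,1)]
      by (metis linorder_neqE_nat)
    with assms(3) show False by simp
  qed
  then have "list_coeff xs = list_coeff ys" by auto
  then show ?thesis
    using cnf_eq_map[OF assms(1)] cnf_eq_map[OF assms(2)] by simp
qed

lemma is_cnf_cnf: "is_cnf (cnf \<alpha>)" and cnf_value_cnf: "cnf_value (cnf \<alpha>) = \<alpha>"
proof -
  obtain xs where "is_cnf xs \<and> cnf_value xs = \<alpha>" using cnf_exists by blast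
  then have "is_cnf (cnf \<alpha>) \<and> cnf_value (cnf \<alpha>) = \<alpha>"
    unfolding cnf_def by (rule theI) (use \<open>_ \<and> _\<close> is_cnf_unique in blast)
  then show "is_cnf (cnf \<alpha>)" "cnf_value (cnf \<alpha>) = \<alpha>" by blast+
qed

lemma cnf_cnf_value: "is_cnf xs \<Longrightarrow> cnf (cnf_value xs) = xs"
  by (intro is_cnf_unique is_cnf_cnf cnf_value_cnf)

section \<open>Coefficient functions of ordinals\<close>

lemma cnf_coeff_eq: "cnf_coeff \<alpha> = list_coeff (cnf \<alpha>)"
  by (simp add: fun_eq_iff cnf_coeff_def list_coeff_def)

lemma cnf_coeff_cnf_value: "is_cnf xs \<Longrightarrow> cnf_coeff (cnf_value xs) = list_coeff xs"
  by (simp add: cnf_coeff_eq cnf_cnf_value)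

lemma exponents_eq: "exponents \<alpha> = {\<zeta>. cnf_coeff \<alpha> \<zeta> \<noteq> 0}"
  by (simp add: exponents_def cnf_coeff_eq list_coeff_pos_iff is_cnf_cnf)

lemma finite_exponents: "finite (exponents \<alpha>)"
  by (simp add: exponents_def)

lemma cnf_coeff_ord_of_coeffs: "finite {\<zeta>. c \<zeta> \<noteq> 0} \<Longrightarrow> cnf_coeff (ord_of_coeffs c) = c"
  unfolding ord_of_coeffs_def by (simp only: cnf_coeff_cnf_value is_cnf_map list_coeff_map)

lemma ord_of_coeffs_cnf_coeff: "ord_of_coeffs (cnf_coeff \<alpha>) = \<alpha>"
  unfolding ord_of_coeffs_def cnf_coeff_eq
  using cnf_eq_map[OF is_cnf_cnf, of \<alpha>] cnf_value_cnf by simp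

lemma cnf_coeff_less:
  assumes "cnf_coeff \<alpha> \<theta> < cnf_coeff \<beta> \<theta>"
    and "\<And>\<zeta>. \<theta> < \<zeta> \<Longrightarrow> cnf_coeff \<alpha> \<zeta> = cnf_coeff \<beta> \<zeta>"
  shows "\<alpha> < \<beta>"
  using cnf_value_less[OF is_cnf_cnf[of \<alpha>] is_cnf_cnf[of \<beta>], of \<theta>] assms
  by (simp add: cnf_coeff_eq cnf_value_cnf)

lemma cnf_coeff_ord_of_nat:
  "cnf_coeff (ord_of_nat n :: 'a ordinal) = (\<lambda>\<zeta>. if \<zeta> = ord_zero then n else 0)"
\<comment> \<open>Normal forms have no zero coefficients, so 0 is the empty list and not a term with
  exponent 0.\<close>
proof (cases "n = 0")
  case True
  then show ?thesis
    using cnf_coeff_cnf_value[OF is_cnf_Nil, where 'a = 'a] by (simp add: fun_eq_iff)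
next
  case False
  then have cnf: "is_cnf [(ord_zero :: 'a ordinal, n)]" by simp
  have "cnf_value [(ord_zero, n)] = (ord_of_nat n :: 'a ordinal)"
    using ord_one_mult_nat[of n, where 'a = 'a] by (simp add: omega_power_zero)
  with cnf_coeff_cnf_value[OF cnf] show ?thesis
    by (auto simp: fun_eq_iff list_coeff_Cons)
qed

section \<open>Transfinite integers\<close>

lemma finite_zcoeff: "finite {\<zeta>. zcoeff a \<zeta> \<noteq> 0}"
proof (rule finite_subset)
  show "{\<zeta>. zcoeff a \<zeta> \<noteq> 0} \<subseteq> exponents (fst a) \<union> exponents (snd a)"
    by (auto simp: zcoeff_def exponents_eq)
qed (simp add: finite_exponents)

lemma
  assumes "finite {\<zeta>. c \<zeta> \<noteq> 0}"
  shows cnf_coeff_fst_zinf: "cnf_coeff (fst (zinf_of_coeffs c)) = (\<lambda>\<zeta>. nat (- c \<zeta>))"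
    and cnf_coeff_snd_zinf: "cnf_coeff (snd (zinf_of_coeffs c)) = (\<lambda>\<zeta>. nat (c \<zeta>))"
proof -
  have "finite {\<zeta>. nat (- c \<zeta>) \<noteq> 0}" "finite {\<zeta>. nat (c \<zeta>) \<noteq> 0}"
    by (rule finite_subset[OF _ assms], force)+
  then show "cnf_coeff (fst (zinf_of_coeffs c)) = (\<lambda>\<zeta>. nat (- c \<zeta>))"
    "cnf_coeff (snd (zinf_of_coeffs c)) = (\<lambda>\<zeta>. nat (c \<zeta>))"
    by (simp_all only: zinf_of_coeffs_def fst_conv snd_conv cnf_coeff_ord_of_coeffs)
qed

lemma zcoeff_zinf_of_coeffs: "finite {\<zeta>. c \<zeta> \<noteq> 0} \<Longrightarrow> zcoeff (zinf_of_coeffs c) = c"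
  by (simp add: fun_eq_iff zcoeff_def cnf_coeff_fst_zinf cnf_coeff_snd_zinf)

text \<open>In \<open>Zinf\<close> at most one coordinate has a nonzero coefficient at each
  exponent. Nothing cancels in \<open>zcoeff\<close>, and its negative and positive parts give back
  the coordinates.\<close>

lemma zinf_of_coeffs_zcoeff:
  assumes "a \<in> Zinf"
  shows "zinf_of_coeffs (zcoeff a) = a"
proof -
  have *: "cnf_coeff (fst a) \<zeta> = 0 \<or> cnf_coeff (snd a) \<zeta> = 0" for \<zeta>
    using assms by (auto simp: Zinf_def exponents_eq)
  have "nat (- zcoeff a \<zeta>) = cnf_coeff (fst a) \<zeta>" "nat (zcoeff a \<zeta>) = cnf_coeff (snd a) \<zeta>"
    for \<zeta> using *[of \<zeta>] by (auto simp: zcoeff_def)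
  then show ?thesis
    by (simp add: zinf_of_coeffs_def ord_of_coeffs_cnf_coeff)
qed

lemma zcoeff_zadd: "zcoeff (zadd a b) = (\<lambda>\<zeta>. zcoeff a \<zeta> + zcoeff b \<zeta>)"
proof -
  have "finite {\<zeta>. zcoeff a \<zeta> + zcoeff b \<zeta> \<noteq> 0}"
    by (rule finite_subset[OF _ finite_UnI[OF finite_zcoeff[of a] finite_zcoeff[of b]]]) auto
  then show ?thesis unfolding zadd_def by (rule zcoeff_zinf_of_coeffs)
qed

lemma zcoeff_zneg: "zcoeff (zneg a) = (\<lambda>\<zeta>. - zcoeff a \<zeta>)"
  by (simp add: fun_eq_iff zcoeff_def zneg_def)

lemma zcoeff_of_nat:
  "zcoeff (ord_zero, ord_of_nat n :: 'a ordinal) = (\<lambda>\<zeta>. if \<zeta> = ord_zero then int n else 0)"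
  using cnf_coeff_ord_of_nat[of 0, where 'a = 'a]
  by (simp add: fun_eq_iff zcoeff_def cnf_coeff_ord_of_nat)

lemma exponents_ord_zero [simp]: "exponents (ord_zero :: 'a ordinal) = {}"
  using cnf_coeff_ord_of_nat[of 0, where 'a = 'a] by (simp add: exponents_eq)

text \<open>The exponent \<theta> is the highest at which the two coordinates differ, so a negative
  value there would make the second coordinate the smaller one.\<close>

lemma Zinf_nonneg_leading_coeff:
  assumes "a \<in> Zinf_nonneg" "zcoeff a \<theta> \<noteq> 0" "\<And>\<zeta>. \<theta> < \<zeta> \<Longrightarrow> zcoeff a \<zeta> = 0"
  shows "0 < zcoeff a \<theta>"
proof (rule ccontr)
  assume "\<not> ?thesis"
  with assms(2) have "zcoeff a \<theta> < 0" by simp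
  then have "snd a < fst a"
    using assms(3) by (intro cnf_coeff_less[of _ \<theta>]) (auto simp: zcoeff_def)
  with assms(1) show False by (auto simp: Zinf_nonneg_def dest: leD)
qed

text \<open>Translates strict inequality into coefficients: distinct elements of \<open>Zinf\<close>
  have distinct coefficient functions, so their difference has a leading exponent.\<close>

lemma zle_leading_coeff:
  assumes "x \<in> Zinf" "y \<in> Zinf" "zle x y" "x \<noteq> y"
  obtains \<theta> where "0 < zcoeff y \<theta> - zcoeff x \<theta>" "\<And>\<zeta>. \<theta> < \<zeta> \<Longrightarrow> zcoeff y \<zeta> = zcoeff x \<zeta>"
proof -
  let ?d = "zadd y (zneg x)"
  have d: "zcoeff ?d = (\<lambda>\<zeta>. zcoeff y \<zeta> - zcoeff x \<zeta>)"
    by (simp add: zcoeff_zadd zcoeff_zneg)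
  have "zcoeff x \<noteq> zcoeff y"
    using assms(1,2,4) by (metis zinf_of_coeffs_zcoeff)
  then obtain \<zeta> where "zcoeff x \<zeta> \<noteq> zcoeff y \<zeta>" by (auto simp: fun_eq_iff)
  then have "\<zeta> \<in> {\<zeta>. zcoeff ?d \<zeta> \<noteq> 0}" by (simp add: d)
  then have ne: "{\<zeta>. zcoeff ?d \<zeta> \<noteq> 0} \<noteq> {}" by blast
  define \<theta> where "\<theta> = Max {\<zeta>. zcoeff ?d \<zeta> \<noteq> 0}"
  have \<theta>: "zcoeff ?d \<theta> \<noteq> 0"
    using Max_in[OF finite_zcoeff ne] by (simp add: \<theta>_def)
  have above: "zcoeff ?d \<zeta> = 0" if "\<theta> < \<zeta>" for \<zeta>
    using Max_ge[OF finite_zcoeff, of \<zeta> ?d] that by (auto simp: not_le[symmetric] \<theta>_def)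
  have "0 < zcoeff ?d \<theta>"
    using assms(3) \<theta> above by (intro Zinf_nonneg_leading_coeff) (auto simp: zle_def)
  with above show thesis by (intro that[of \<theta>]) (auto simp: d)
qed

lemma zadd_mem_Zinf: "zadd a b \<in> Zinf"
proof -
  have fin: "finite {\<zeta>. zcoeff a \<zeta> + zcoeff b \<zeta> \<noteq> 0}"
    using finite_zcoeff[of "zadd a b"] by (simp add: zcoeff_zadd)
  show ?thesis
    unfolding zadd_def Zinf_def
    by (simp add: case_prod_beta exponents_eq cnf_coeff_fst_zinf[OF fin] cnf_coeff_snd_zinf[OF fin])
      auto
qed

section \<open>Discreteness\<close>

lemma discrete_Z_ring: "discrete_ring (Z_ring \<mu>)"
proof -
  have False if x: "x \<in> Zinf" and y: "y \<in> Zinf" and xy: "zle x y" "x \<noteq> y"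
    and yx: "zle y (zadd x zone)" "y \<noteq> zadd x zone" for x y :: "'a ord_pair"
  proof -
    obtain \<theta> where \<theta>: "0 < zcoeff y \<theta> - zcoeff x \<theta>"
      "\<And>\<zeta>. \<theta> < \<zeta> \<Longrightarrow> zcoeff y \<zeta> = zcoeff x \<zeta>"
      using zle_leading_coeff[OF x y xy] by blast
    obtain \<eta> where \<eta>: "0 < zcoeff (zadd x zone) \<eta> - zcoeff y \<eta>"
      "\<And>\<zeta>. \<eta> < \<zeta> \<Longrightarrow> zcoeff (zadd x zone) \<zeta> = zcoeff y \<zeta>"
      using zle_leading_coeff[OF y zadd_mem_Zinf yx] by blast
    have z: "zcoeff (zadd x zone) \<zeta> = zcoeff x \<zeta> + (if \<zeta> = ord_zero then 1 else 0)" for \<zeta>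
      using zcoeff_of_nat[of 1, where 'a = 'a] by (simp add: zcoeff_zadd zone_def)
    \<comment> \<open>The differences \<open>y - x\<close> and \<open>(x + 1) - y\<close>, with
      leading exponents \<theta> and \<eta>, add up to 1. If \<theta> and \<eta> differ, the larger
      is nonzero and only one difference contributes there, though 1 has coefficient 0. If they
      agree, two positive integers would add up to at most 1.\<close>
    consider "\<theta> < \<eta>" | "\<eta> < \<theta>" | "\<theta> = \<eta>" by fastforce
    then show False
    proof cases
      case 1
      then have "\<eta> \<noteq> ord_zero" by auto
      with \<theta>(2)[OF 1] \<eta>(1) show False by (simp add: z)
    next
      case 2
      then have "\<theta> \<noteq> ord_zero" by auto
      with \<eta>(2)[OF 2] \<theta>(1) show False by (simp add: z)
    next
      case 3
      with \<theta>(1) \<eta>(1) show False by (simp add: z split: if_splits)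
    qed
  qed
  then show ?thesis
    by (auto simp: discrete_ring_def ring_less_def Z_ring_def)
qed

section \<open>Cyclicity\<close>

lemma add_pow_Z_ring_one: "[n] \<cdot>\<^bsub>Z_ring \<mu>\<^esub> \<one>\<^bsub>Z_ring \<mu>\<^esub> = (ord_zero, ord_of_nat n)"
proof (induction n)
  case 0
  then show ?case by (simp add: add_pow_def Z_ring_def zzero_def)
next
  case (Suc n)
  have Zinf: "(ord_zero, ord_of_nat k) \<in> Zinf" for k
    by (simp add: Zinf_def)
  have "zadd (ord_zero, ord_of_nat n) zone = (ord_zero, ord_of_nat (Suc n))"
  proof -
    have "zcoeff (zadd (ord_zero, ord_of_nat n) zone) = zcoeff (ord_zero, ord_of_nat (Suc n))"
      unfolding zcoeff_zadd zone_def zcoeff_of_nat by auto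
    then show ?thesis
      using zinf_of_coeffs_zcoeff[OF zadd_mem_Zinf] zinf_of_coeffs_zcoeff[OF Zinf] by metis
  qed
  with Suc show ?case by (simp add: add_pow_def Z_ring_def)
qed

lemma cyclic_Z_ring_iff:
  "cyclic_ring (Z_ring \<mu>) \<longleftrightarrow> (\<forall>a \<in> Zinf. fst a < \<mu> \<and> snd a < \<mu> \<longrightarrow>
    (\<exists>n. a = (ord_zero, ord_of_nat n) \<or> a = (ord_of_nat n, ord_zero)))"
proof -
  have "carrier (Z_ring \<mu>) = {a \<in> Zinf. fst a < \<mu> \<and> snd a < \<mu>}" "ring_neg (Z_ring \<mu>) = zneg"
    by (simp_all add: Z_ring_def)
  then show ?thesis
    by (simp only: cyclic_ring_def add_pow_Z_ring_one) (auto simp: zneg_def)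
qed

lemma cyclic_Z_ring_omega: "cyclic_ring (Z_ring ord_omega)"
  unfolding cyclic_Z_ring_iff
proof (intro ballI impI)
  fix a :: "'a ord_pair"
  assume a: "a \<in> Zinf" and "fst a < ord_omega \<and> snd a < ord_omega"
  then obtain m n where mn: "a = (ord_of_nat m, ord_of_nat n)"
    by (auto simp: less_ord_omega_iff prod_eq_iff)
  \<comment> \<open>A nonzero natural number has exponent 0, which the two coordinates may not
    share.\<close>
  have "ord_zero \<notin> exponents (ord_of_nat m :: 'a ordinal) \<inter> exponents (ord_of_nat n)"
    using a by (simp add: mn Zinf_def)
  then have "m = 0 \<or> n = 0"
    by (simp add: exponents_eq cnf_coeff_ord_of_nat)
  with mn show "\<exists>n. a = (ord_zero, ord_of_nat n) \<or> a = (ord_of_nat n, ord_zero)"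
    by (metis ord_of_nat.simps(1))
qed

lemma not_cyclic_Z_ring:
  fixes \<mu> :: "'a ordinal"
  assumes "ord_omega < \<mu>"
  shows "\<not> cyclic_ring (Z_ring \<mu>)"
proof
  assume cyclic: "cyclic_ring (Z_ring \<mu>)"
  have "(ord_zero, ord_omega :: 'a ordinal) \<in> Zinf" by (simp add: Zinf_def)
  moreover have "ord_zero < \<mu>" using assms by (rule le_less_trans[OF ord_zero_le])
  ultimately obtain n where "ord_omega = (ord_of_nat n :: 'a ordinal) \<or> ord_omega = (ord_zero :: 'a ordinal)"
    using cyclic[unfolded cyclic_Z_ring_iff, rule_format, of "(ord_zero, ord_omega)"] assms by auto
  \<comment> \<open>In either case \<omega> would be finite, as \<open>ord_zero\<close> is
    \<open>ord_of_nat 0\<close>.\<close>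
  then obtain k where "ord_omega = (ord_of_nat k :: 'a ordinal)"
    using ord_of_nat.simps(1) by metis
  then show False
    using ord_of_nat_less_omega[of k, where 'a = 'a] by simp
qed

theorem theorem9p37:
  "(\<forall>\<mu> :: 'a ordinal. transfinite_times_number \<mu> \<longrightarrow> discrete_ring (Z_ring \<mu>)) \<and>
   cyclic_ring (Z_ring (ord_omega :: 'a ordinal)) \<and>
   (\<forall>\<mu> :: 'a ordinal. transfinite_times_number \<mu> \<longrightarrow>
      (cyclic_ring (Z_ring \<mu>) \<longleftrightarrow> \<mu> = ord_omega))"
  \<comment> \<open>A transfinite times-number is at least \<omega>, so the last part splits into
    equality and strict inequality.\<close>
  using discrete_Z_ring cyclic_Z_ring_omega not_cyclic_Z_ring
  by (auto simp: transfinite_times_number_def le_less)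

end
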